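(* Let $\mathcal{E}$ be the left hand side of any one of the deformed equations ${\rm H1}^\sigma_\epsilon$, ${\rm H2}^\sigma_\epsilon$, ${\rm H3}^\sigma_\epsilon$, with $\sigma=\pm1$. Let $u^0$ be a solution of the deformed equation $$\mathcal{E}(u_{n,m},u_{n+1,m},u_{n,m+1},u_{n+1,m+1};n,m;\alpha,\beta;\sigma)=0,\qquad(\ast)$$ and let $v^1,v^2$ be the solutions of its counterpart $$\mathcal{E}(v_{n,m},v_{n+1,m},v_{n,m+1},v_{n+1,m+1};n,m;\alpha,\beta;-\sigma)=0$$ generated by $u^0$ via the Bäcklund transformation $\mathbb{B}$ with parameters $\lambda_1$ and $\lambda_2$, respectively. Then there is a new solution $u^{12}$ of equation $(\ast)$, which is constructed according to the Bianchi commuting diagram $$u^0\xrightarrow{\lambda_1}v^1\xrightarrow{\lambda_2}u^{12},\qquad u^0\xrightarrow{\lambda_2}v^2\xrightarrow{\lambda_1}u^{12},$$ and is given algebraically by $$\mathcal{E}\left(u^0,v^1,v^2,u^{12};n,m;\lambda_1,\lambda_2;\sigma\right)=0,$$ where $u^0,v^1,v^2,u^{12}$ are all evaluated at $(n,m)$.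
   Context: The unknowns are functions $\mathbb{Z}\times\mathbb{Z}\to\mathbb{C}$, with $u_{n,m}=u(n,m)$, and all equations are understood at every lattice point $(n,m)$. $\alpha,\beta$ are the lattice parameters, $\epsilon,\delta$ are constants, and $\sigma=\pm1$. Put $$\mathcal{X}_{n,m}=\frac{1+\sigma(-1)^{n+m}}{2},\qquad \mathcal{Y}_{n,m}=\frac{1-\sigma(-1)^{n+m}}{2}$$ (replacing $\sigma$ by $-\sigma$ interchanges the two functions). The polynomial $\mathcal{E}(x_1,x_2,x_3,x_4;n,m;\alpha,\beta;\sigma)$, affine linear in each $x_i$, is one of the following: - ${\rm H1}^\sigma_\epsilon$: $(x_1-x_4)(x_2-x_3)-(\alpha-\beta)+\epsilon(\alpha-\beta)\{\mathcal{X}_{n,m}x_2x_3+\mathcal{Y}_{n,m}x_1x_4\}$; - ${\rm H2}^\sigma_\epsilon$: $(x_1-x_4)(x_2-x_3)+(\beta-\alpha)(x_1+x_2+x_3+x_4)-\alpha^2+\beta^2-\epsilon(\beta-\alpha)^3-\epsilon(\beta-\alpha)\{2\mathcal{Y}_{n,m}x_1+2\mathcal{X}_{n,m}x_2+\alpha+\beta\}\{2\mathcal{Y}_{n,m}x_4+2\mathcal{X}_{n,m}x_3+\alpha+\beta\}$; - ${\rm H3}^\sigma_\epsilon$: $\alpha(x_1x_2+x_3x_4)-\beta(x_1x_3+x_2x_4)+(\alpha^2-\beta^2)\delta-\frac{\epsilon(\alpha^2-\beta^2)}{\alpha\beta}\{\mathcal{X}_{n,m}x_2x_3+\mathcal{Y}_{n,m}x_1x_4\}$.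 Other displayed pairs of parameters, such as $(\alpha,\lambda)$, $(\beta,\lambda)$ or $(\lambda_1,\lambda_2)$, replace $(\alpha,\beta)$ in these formulas. The Bäcklund transformation $\mathbb{B}$ with parameter $\lambda$ takes a solution $u$ of the equation with sign $\sigma$ to the solution $v$ of the equation with sign $-\sigma$ determined by the system $$\mathcal{E}(u_{n,m},u_{n+1,m},v_{n,m},v_{n+1,m};n,m;\alpha,\lambda;\sigma)=0,\qquad \mathcal{E}(u_{n,m},u_{n,m+1},v_{n,m},v_{n,m+1};n,m;\beta,\lambda;\sigma)=0;$$ the transformation from solutions $v$ of the equation with sign $-\sigma$ to solutions $u$ of the equation with sign $\sigma$ is given by the same system with $u,v$ interchanged and $\sigma$ replaced by $-\sigma$. In the Bianchi diagram, an arrow labelled $\lambda$ means that its target is obtained from its source by this transformation with parameter $\lambda$.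
   Formalization: Added assumption: at every lattice point the equation E(u⁰,v¹,v²,x;n,m;λ1,λ2;σ)=0 has exactly one root x; without it u¹² may fail to exist (e.g. v¹=v² at a point with λ1≠λ2 for H1, ε=0). For H3 all parameters are taken nonzero. *)

theory Defs
  imports Complex_Main
begin

type_synonym lattice_fun = "int \<Rightarrow> int \<Rightarrow> complex"

definition chi_X :: "int \<Rightarrow> int \<Rightarrow> complex \<Rightarrow> complex" where
  "chi_X n m \<sigma> = (1 + \<sigma> * (-1) powi (n + m)) / 2"

definition chi_Y :: "int \<Rightarrow> int \<Rightarrow> complex \<Rightarrow> complex" where
  "chi_Y n m \<sigma> = (1 - \<sigma> * (-1) powi (n + m)) / 2"

datatype deformed_family = H1 | H2 | H3

text \<open>
  Left hand sides of the deformed equations. The constant \<delta> occurs in the third equation only.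
  That equation divides by \<alpha> \<beta>, so it is meaningful only for nonzero parameters
  (see \<open>admissible_param\<close> below).
\<close>

fun quad_poly :: "deformed_family \<Rightarrow> complex \<Rightarrow> complex \<Rightarrow>
    complex \<Rightarrow> complex \<Rightarrow> complex \<Rightarrow> complex \<Rightarrow> int \<Rightarrow> int \<Rightarrow> complex \<Rightarrow> complex \<Rightarrow> complex \<Rightarrow> complex" where
  "quad_poly H1 \<epsilon> \<delta> x1 x2 x3 x4 n m \<alpha> \<beta> \<sigma> =
     (x1 - x4) * (x2 - x3) - (\<alpha> - \<beta>)
     + \<epsilon> * (\<alpha> - \<beta>) * (chi_X n m \<sigma> * x2 * x3 + chi_Y n m \<sigma> * x1 * x4)"
| "quad_poly H2 \<epsilon> \<delta> x1 x2 x3 x4 n m \<alpha> \<beta> \<sigma> =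
     (x1 - x4) * (x2 - x3) + (\<beta> - \<alpha>) * (x1 + x2 + x3 + x4) - \<alpha>^2 + \<beta>^2
     - \<epsilon> * (\<beta> - \<alpha>)^3
     - \<epsilon> * (\<beta> - \<alpha>) * (2 * chi_Y n m \<sigma> * x1 + 2 * chi_X n m \<sigma> * x2 + \<alpha> + \<beta>)
                   * (2 * chi_Y n m \<sigma> * x4 + 2 * chi_X n m \<sigma> * x3 + \<alpha> + \<beta>)"
| "quad_poly H3 \<epsilon> \<delta> x1 x2 x3 x4 n m \<alpha> \<beta> \<sigma> =
     \<alpha> * (x1 * x2 + x3 * x4) - \<beta> * (x1 * x3 + x2 * x4) + (\<alpha>^2 - \<beta>^2) * \<delta>
     - \<epsilon> * (\<alpha>^2 - \<beta>^2) / (\<alpha> * \<beta>) * (chi_X n m \<sigma> * x2 * x3 + chi_Y n m \<sigma> * x1 * x4)"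

definition admissible_param :: "deformed_family \<Rightarrow> complex \<Rightarrow> bool" where
  "admissible_param K a \<longleftrightarrow> (K = H3 \<longrightarrow> a \<noteq> 0)"

definition is_solution ::
  "deformed_family \<Rightarrow> complex \<Rightarrow> complex \<Rightarrow> complex \<Rightarrow> complex \<Rightarrow> complex \<Rightarrow> lattice_fun \<Rightarrow> bool" where
  "is_solution K \<epsilon> \<delta> \<alpha> \<beta> \<sigma> u \<longleftrightarrow>
     (\<forall>n m. quad_poly K \<epsilon> \<delta> (u n m) (u (n+1) m) (u n (m+1)) (u (n+1) (m+1)) n m \<alpha> \<beta> \<sigma> = 0)"

text \<open>
  \<open>backlund K \<epsilon> \<delta> \<alpha> \<beta> l \<sigma> u v\<close>: the solution \<open>v\<close> of the equation with sign -\<sigma> is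
  obtained from the solution \<open>u\<close> of the equation with sign \<sigma> by the Backlund transformation with
  parameter \<open>l\<close>. It is a relation rather than a function because the system determines \<open>v\<close>
  only up to its value at one lattice point. The transformation in the opposite direction is the
  instance with \<open>-\<sigma>\<close> in place of \<open>\<sigma>\<close>.
\<close>

definition backlund ::
  "deformed_family \<Rightarrow> complex \<Rightarrow> complex \<Rightarrow> complex \<Rightarrow> complex \<Rightarrow> complex \<Rightarrow> complex
    \<Rightarrow> lattice_fun \<Rightarrow> lattice_fun \<Rightarrow> bool" where
  "backlund K \<epsilon> \<delta> \<alpha> \<beta> l \<sigma> u v \<longleftrightarrow>
     is_solution K \<epsilon> \<delta> \<alpha> \<beta> \<sigma> u \<and>
     is_solution K \<epsilon> \<delta> \<alpha> \<beta> (-\<sigma>) v \<and>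
     (\<forall>n m. quad_poly K \<epsilon> \<delta> (u n m) (u (n+1) m) (v n m) (v (n+1) m) n m \<alpha> l \<sigma> = 0 \<and>
            quad_poly K \<epsilon> \<delta> (u n m) (u n (m+1)) (v n m) (v n (m+1)) n m \<beta> l \<sigma> = 0)"

end

theory Submission
  imports Defs
begin

text \<open>
  The values of \<open>u0\<close>, \<open>v1\<close>, \<open>v2\<close>, \<open>u12\<close> on an elementary square are attached to the sixteen vertices
  of a four-dimensional cube with directions \<open>\<alpha>\<close>, \<open>\<beta>\<close>, \<open>l1\<close>, \<open>l2\<close>. Its vertices are coloured black and
  white by parity, according to the sign of \<open>\<sigma> (-1)^(n+m)\<close>. Then the same expression occurs on every
  two-dimensional face. It is affine linear in each variable, and \<open>\<epsilon>\<close> involves only the black diagonal.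
  For generic data the claim is the consistency of this
  equation around three-dimensional cubes. No genericity is assumed apart from the unique solvability
  for \<open>u12\<close>, and a single cube does not suffice: for H3 with \<open>\<delta> = 0\<close> and \<open>\<epsilon> \<noteq> 0\<close>, five faces may hold
  and the sixth fail. Therefore both steps rest on polynomial identities that express the
  missing face, multiplied only by coefficients that unique solvability makes nonzero, as a combination
  of the known faces; for the equation of \<open>u12\<close> these faces come from the whole four-dimensional cube.
\<close>

subsection \<open>Quadrilaterals with a black diagonal\<close>

text \<open>
  The black diagonal is \<open>p, q\<close> and the white one is \<open>y, z\<close>; the edges \<open>p y\<close> and \<open>z q\<close> carry the
  parameter \<open>a\<close>, the edges \<open>p z\<close> and \<open>y q\<close> the parameter \<open>b\<close>.
\<close>

fun black_quad :: "deformed_family \<Rightarrow> complex \<Rightarrow> complex \<Rightarrow> complex \<Rightarrow> complex \<Rightarrow>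
    complex \<Rightarrow> complex \<Rightarrow> complex \<Rightarrow> complex \<Rightarrow> complex" where
  "black_quad H1 \<epsilon> \<delta> a b p y z q = (p - q) * (y - z) - (a - b) + \<epsilon> * (a - b) * p * q"
| "black_quad H2 \<epsilon> \<delta> a b p y z q =
     (p - q) * (y - z) + (b - a) * (p + y + z + q) - a^2 + b^2 - \<epsilon> * (b - a)^3
     - \<epsilon> * (b - a) * (2 * p + a + b) * (2 * q + a + b)"
| "black_quad H3 \<epsilon> \<delta> a b p y z q =
     a * (p * y + z * q) - b * (p * z + y * q) + (a^2 - b^2) * \<delta>
     - \<epsilon> * (a^2 - b^2) / (a * b) * p * q"

text \<open>A denominator-free form of the H3 quadrilateral, with \<open>k = \<epsilon> / (a b)\<close>.\<close>

definition quad_H3 :: "complex \<Rightarrow> complex \<Rightarrow> complex \<Rightarrow> complex \<Rightarrow>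
    complex \<Rightarrow> complex \<Rightarrow> complex \<Rightarrow> complex \<Rightarrow> complex" where
  "quad_H3 \<delta> k a b p y z q = a * (p * y + z * q) - b * (p * z + y * q) + (a^2 - b^2) * (\<delta> - k * p * q)"

lemma black_quad_H3:
  assumes "a \<noteq> 0" "b \<noteq> 0" "\<epsilon> = k * a * b"
  shows "black_quad H3 \<epsilon> \<delta> a b = quad_H3 \<delta> k a b"
  using assms by (intro ext) (simp add: quad_H3_def field_simps)

lemma black_quad_swap: "black_quad K \<epsilon> \<delta> b a p z y q = - black_quad K \<epsilon> \<delta> a b p y z q"
  by (cases K) (simp_all add: algebra_simps power2_eq_square power3_eq_cube diff_divide_distrib add_divide_distrib)

lemma black_quad_flip: "black_quad K \<epsilon> \<delta> a b q z y p = black_quad K \<epsilon> \<delta> a b p y z q"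
  by (cases K) (simp_all add: algebra_simps)

text \<open>For affine linear \<open>f\<close> this is the leading coefficient; written as a
  difference of two values, it unfolds to an expression that \<open>algebra\<close> can
  handle.\<close>

definition slope :: "(complex \<Rightarrow> complex) \<Rightarrow> complex" where
  "slope f = f 1 - f 0"

text \<open>With slope zero the function is constant, so it has no root or every number is one. This
  turns unique solvability into a nonzero factor.\<close>

lemma slope_nonzero:
  assumes affine: "\<And>x. f x = f 0 + x * slope f" and uniq: "\<exists>!x. f x = 0"
  shows "slope f \<noteq> 0"
proof
  assume "slope f = 0"
  then have "f x = f 0" for x
    using affine[of x] by simp
  then show False
    using uniq by (metis zero_neq_one)
qed

lemma black_quad_affine_black:
  "black_quad K \<epsilon> \<delta> a b p y z q
     = black_quad K \<epsilon> \<delta> a b p y z 0 + q * slope (black_quad K \<epsilon> \<delta> a b p y z)"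
  by (cases K) (simp_all add: slope_def algebra_simps diff_divide_distrib add_divide_distrib)

lemma black_quad_affine_white:
  "black_quad K \<epsilon> \<delta> a b p y z q
     = black_quad K \<epsilon> \<delta> a b p y 0 q + z * slope (\<lambda>z. black_quad K \<epsilon> \<delta> a b p y z q)"
  by (cases K) (simp_all add: slope_def algebra_simps diff_divide_distrib add_divide_distrib)

subsection \<open>Consistency around a three-dimensional cube\<close>

text \<open>
  The combination \<open>R w\<close> is the resultant, with respect to \<open>q23\<close>, of the wanted face and the face of
  \<open>p, y2, y3\<close>. The cofactors were found by solving a linear system for their coefficients.
\<close>

lemma cube_identity_H1:
  fixes \<epsilon> \<delta> a1 a2 a3 p y1 y2 y3 q12 q13 w :: complex
  defines "Q \<equiv> black_quad H1 \<epsilon> \<delta>"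
  defines "R \<equiv> \<lambda>w. slope (Q a2 a3 p y2 y3) * Q a1 a3 q12 y2 w 0 - slope (Q a1 a3 q12 y2 w) * Q a2 a3 p y2 y3 0"
  shows "slope (\<lambda>z. Q a2 a3 q12 y1 z q13) * R w = slope R * Q a2 a3 q12 y1 w q13
    + ((y2 - y3) * (q12 - q13) + (a2 - a3) * (1 - \<epsilon> * q12 * q13)) * Q a1 a2 p y1 y2 q12
    + (a3 - a2) * (1 - \<epsilon> * q12^2) * Q a1 a3 p y1 y3 q13"
  unfolding assms slope_def black_quad.simps by algebra

lemma cube_identity_H2:
  fixes \<epsilon> \<delta> a1 a2 a3 p y1 y2 y3 q12 q13 w :: complex
  defines "Q \<equiv> black_quad H2 \<epsilon> \<delta>"
    and "s \<equiv> 2 * a1 + a2 - a3"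
  defines "R \<equiv> \<lambda>w. slope (Q a2 a3 p y2 y3) * Q a1 a3 q12 y2 w 0 - slope (Q a1 a3 q12 y2 w) * Q a2 a3 p y2 y3 0"
  shows "slope (\<lambda>z. Q a2 a3 q12 y1 z q13) * R w = slope R * Q a2 a3 q12 y1 w q13
    + ((y2 - y3) * (q12 - q13) + (a2 - a3) * (y2 + y3 + q12 + q13 + s)
       - \<epsilon> * (a2 - a3) * (2 * q12 + s) * (2 * q13 + s) + \<epsilon> * (a3 - a2)^3) * Q a1 a2 p y1 y2 q12
    + 2 * (a3 - a2) * (y2 + q12 + a1 - 2 * \<epsilon> * (q12 + a1)^2) * Q a1 a3 p y1 y3 q13"
  unfolding assms slope_def black_quad.simps by algebra

lemma cube_identity_H3:
  fixes e \<delta> a1 a2 a3 p y1 y2 y3 q12 q13 w :: complex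
  defines "Q12 \<equiv> quad_H3 \<delta> (e * a3) a1 a2"
    and "Q13 \<equiv> quad_H3 \<delta> (e * a2) a1 a3"
    and "Q23 \<equiv> quad_H3 \<delta> (e * a1) a2 a3"
  defines "R \<equiv> \<lambda>w. slope (Q23 p y2 y3) * Q13 q12 y2 w 0 - slope (Q13 q12 y2 w) * Q23 p y2 y3 0"
  shows "slope (\<lambda>z. Q23 q12 y1 z q13) * R w = slope R * Q23 q12 y1 w q13
    + (a3 * (a3 * (y2 * q12 + y3 * q13) - a2 * (y2 * q13 + y3 * q12))
       + (a3^2 - a2^2) * (a1 * \<delta> - e * a3^2 * q12 * q13)) * Q12 p y1 y2 q12
    + (a2^2 - a3^2) * (y2 * q12 + a1 * \<delta> - e * a2 * a3 * q12^2) * Q13 p y1 y3 q13"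
  unfolding assms slope_def quad_H3_def by algebra

text \<open>On the known faces the resultant identity reduces to \<open>D * R w = 0\<close>.
  Uniqueness of \<open>w\<close> allows cancelling \<open>D\<close>, and uniqueness of
  \<open>q23\<close> allows cancelling \<open>L\<close>, which passes from the resultant to the
  wanted face.\<close>

lemma cube_black:
  assumes params: "admissible_param K a1" "admissible_param K a2" "admissible_param K a3"
    and F12: "black_quad K \<epsilon> \<delta> a1 a2 p y1 y2 q12 = 0"
    and F13: "black_quad K \<epsilon> \<delta> a1 a3 p y1 y3 q13 = 0"
    and F23: "black_quad K \<epsilon> \<delta> a2 a3 p y2 y3 q23 = 0"
    and G23: "black_quad K \<epsilon> \<delta> a2 a3 q12 y1 w q13 = 0"
    and q23: "\<exists>!x. black_quad K \<epsilon> \<delta> a2 a3 p y2 y3 x = 0"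
    and w: "\<exists>!x. black_quad K \<epsilon> \<delta> a2 a3 q12 y1 x q13 = 0"
  shows "black_quad K \<epsilon> \<delta> a1 a3 q12 y2 w q23 = 0"
proof -
  define Q where "Q = black_quad K \<epsilon> \<delta>"
  define L where "L = slope (Q a2 a3 p y2 y3)"
  define D where "D = slope (\<lambda>z. Q a2 a3 q12 y1 z q13)"
  define R where "R = (\<lambda>w. L * Q a1 a3 q12 y2 w 0 - slope (Q a1 a3 q12 y2 w) * Q a2 a3 p y2 y3 0)"
  have "L \<noteq> 0"
    unfolding L_def Q_def using q23 by (intro slope_nonzero black_quad_affine_black)
  have "D \<noteq> 0"
    unfolding D_def Q_def using w by (intro slope_nonzero black_quad_affine_white)
  have "D * R w = 0"
  proof (cases K)
    case H1
    then show ?thesis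
      using cube_identity_H1[of \<epsilon> \<delta> a2 a3 q12 y1 q13 p y2 y3 a1 w] F12 F13 G23
      by (simp add: D_def R_def L_def Q_def)
  next
    case H2
    then show ?thesis
      using cube_identity_H2[of \<epsilon> \<delta> a2 a3 q12 y1 q13 p y2 y3 a1 w] F12 F13 G23
      by (simp add: D_def R_def L_def Q_def)
  next
    case H3
    with params have nz: "a1 \<noteq> 0" "a2 \<noteq> 0" "a3 \<noteq> 0"
      by (simp_all add: admissible_param_def)
    \<comment> \<open>For each pair of directions, \<epsilon> divided by both parameters is
      \<open>e\<close> times the third parameter.\<close>
    define e where "e = \<epsilon> / (a1 * a2 * a3)"
    have "\<epsilon> = (e * a3) * a1 * a2" "\<epsilon> = (e * a2) * a1 * a3" "\<epsilon> = (e * a1) * a2 * a3"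
      using nz by (simp_all add: e_def)
    with nz have "Q a1 a2 = quad_H3 \<delta> (e * a3) a1 a2" "Q a1 a3 = quad_H3 \<delta> (e * a2) a1 a3"
        "Q a2 a3 = quad_H3 \<delta> (e * a1) a2 a3"
      unfolding Q_def H3 by (blast intro: black_quad_H3)+
    then show ?thesis
      using cube_identity_H3[of \<delta> e a1 a2 a3 q12 y1 q13 p y2 y3 w] F12 F13 G23
      by (simp add: D_def R_def L_def Q_def[symmetric])
  qed
  with \<open>D \<noteq> 0\<close> have "R w = 0"
    by simp
  \<comment> \<open>Eliminating \<open>q23\<close> without division: this value of
    \<open>q23 * L\<close>, inserted into \<open>L\<close> times the wanted face, yields
    \<open>R w\<close>.\<close>
  have "q23 * L = - Q a2 a3 p y2 y3 0"
    using F23 black_quad_affine_black[of K \<epsilon> \<delta> a2 a3 p y2 y3 q23]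
    by (simp add: L_def Q_def add_eq_0_iff)
  then have "L * Q a1 a3 q12 y2 w q23 = R w"
    using black_quad_affine_black[of K \<epsilon> \<delta> a1 a3 q12 y2 w q23]
    by (simp add: R_def Q_def[symmetric]) algebra
  with \<open>R w = 0\<close> \<open>L \<noteq> 0\<close> show ?thesis
    by (simp add: Q_def)
qed

subsection \<open>Consistency around the four-dimensional cube\<close>

text \<open>
  The vertex \<open>p\<close> is black, \<open>yi\<close>, \<open>qij\<close>, \<open>wijk\<close> are its translates in the indicated directions and
  \<open>r\<close> is the vertex opposite to \<open>p\<close>. The coefficient of \<open>qij\<close> in the face of \<open>p, yi, yj\<close> is
  a coboundary \<open>\<eta>j - \<eta>i\<close>, after division by \<open>ai aj\<close> in the case of H3. This suggests an ansatz
  in which each face that does not contain \<open>p\<close> is multiplied by one of these coefficients. The remaining cofactors are determined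
  by linear equations.
\<close>

lemma tesseract_identity_H1:
  fixes \<epsilon> \<delta> a1 a2 a3 a4 p y1 y2 y3 y4 q12 q13 q14 q23 q24 q34 w123 w124 w134 w234 r :: complex
  defines "Q \<equiv> black_quad H1 \<epsilon> \<delta>"
  shows "slope (Q a3 a4 p y3 y4) * Q a1 a2 q34 w134 w234 r =
      slope (Q a1 a2 p y1 y2) * Q a1 a4 q12 y2 w124 q24
    - slope (Q a1 a2 p y1 y2) * Q a3 a4 q12 w123 w124 r
    + slope (Q a1 a3 p y1 y3) * Q a2 a4 q13 w123 w134 r
    - slope (Q a1 a3 p y1 y3) * Q a2 a3 q12 y1 w123 q13
    - slope (Q a1 a3 p y1 y3) * Q a3 a4 q13 y1 w134 q14
    - slope (Q a1 a4 p y1 y4) * Q a1 a2 q14 y4 w124 q24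
    - slope (Q a1 a4 p y1 y4) * Q a2 a3 q14 w124 w134 r
    + slope (Q a2 a3 p y2 y3) * Q a1 a3 q12 y2 w123 q23
    + slope (Q a2 a3 p y2 y3) * Q a3 a4 q23 y2 w234 q24
    - slope (Q a2 a3 p y2 y3) * Q a1 a4 q23 w123 w234 r
    + slope (Q a2 a4 p y2 y4) * Q a1 a3 q24 w124 w234 r
    + slope (Q a3 a4 p y3 y4) * Q a1 a3 q14 y4 w134 q34
    - slope (Q a3 a4 p y3 y4) * Q a2 a3 q24 y4 w234 q34
    + (y1 - y3 + \<epsilon> * ((a4 - a1) * q24 + (a3 - a4) * r)) * Q a1 a2 p y1 y2 q12
    + (\<epsilon> * ((a2 - a3) * q12 + (a3 - a4) * q14 + (a4 - a2) * r)) * Q a1 a3 p y1 y3 q13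
    + (y3 - y1 + \<epsilon> * ((a1 - a2) * q24 + (a2 - a3) * r)) * Q a1 a4 p y1 y4 q14
    + (\<epsilon> * ((a3 - a1) * q12 + (a4 - a3) * q24 + (a1 - a4) * r)) * Q a2 a3 p y2 y3 q23
    + (y1 - y3 + \<epsilon> * ((a3 - a1) * r)) * Q a2 a4 p y2 y4 q24
    + (\<epsilon> * ((a3 - a1) * q14 + (a2 - a3) * q24 + (a1 - a2) * r)) * Q a3 a4 p y3 y4 q34"
  unfolding assms slope_def black_quad.simps by algebra

lemma tesseract_identity_H2:
  fixes \<epsilon> \<delta> a1 a2 a3 a4 p y1 y2 y3 y4 q12 q13 q14 q23 q24 q34 w123 w124 w134 w234 r :: complex
  defines "Q \<equiv> black_quad H2 \<epsilon> \<delta>"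
  shows "slope (Q a3 a4 p y3 y4) * Q a1 a2 q34 w134 w234 r =
      slope (Q a1 a2 p y1 y2) * Q a1 a4 q12 y2 w124 q24
    - slope (Q a1 a2 p y1 y2) * Q a3 a4 q12 w123 w124 r
    + slope (Q a1 a3 p y1 y3) * Q a2 a4 q13 w123 w134 r
    - slope (Q a1 a3 p y1 y3) * Q a2 a3 q12 y1 w123 q13
    - slope (Q a1 a3 p y1 y3) * Q a3 a4 q13 y1 w134 q14
    - slope (Q a1 a4 p y1 y4) * Q a1 a2 q14 y4 w124 q24
    - slope (Q a1 a4 p y1 y4) * Q a2 a3 q14 w124 w134 r
    + slope (Q a2 a3 p y2 y3) * Q a1 a3 q12 y2 w123 q23
    + slope (Q a2 a3 p y2 y3) * Q a3 a4 q23 y2 w234 q24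
    - slope (Q a2 a3 p y2 y3) * Q a1 a4 q23 w123 w234 r
    + slope (Q a2 a4 p y2 y4) * Q a1 a3 q24 w124 w234 r
    + slope (Q a3 a4 p y3 y4) * Q a1 a3 q14 y4 w134 q34
    - slope (Q a3 a4 p y3 y4) * Q a2 a3 q24 y4 w234 q34
    + (y1 - y3 + (a1 - a3) * (1 - 2 * \<epsilon> * (a1 + 2 * a2 - a3))
       + 4 * \<epsilon> * ((a4 - a1) * q24 + (a3 - a4) * r)) * Q a1 a2 p y1 y2 q12
    + (4 * \<epsilon> * ((a2 - a3) * q12 + (a3 - a4) * q14 + (a4 - a2) * r)) * Q a1 a3 p y1 y3 q13
    + (y3 - y1 + (a3 - a1) * (1 + 2 * \<epsilon> * (a3 - a1 - 2 * a4))
       + 4 * \<epsilon> * ((a1 - a2) * q24 + (a2 - a3) * r)) * Q a1 a4 p y1 y4 q14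
    + (4 * \<epsilon> * ((a3 - a1) * q12 + (a4 - a3) * q24 + (a1 - a4) * r)) * Q a2 a3 p y2 y3 q23
    + (y1 - y3 + (a1 - a3) * (1 - 2 * \<epsilon> * (2 * a2 + 2 * a4 - a1 - a3))
       + 4 * \<epsilon> * ((a3 - a1) * r)) * Q a2 a4 p y2 y4 q24
    + (4 * \<epsilon> * ((a3 - a1) * q14 + (a2 - a3) * q24 + (a1 - a2) * r)) * Q a3 a4 p y3 y4 q34"
  unfolding assms slope_def black_quad.simps by algebra

lemma tesseract_identity_H3:
  fixes e \<delta> a1 a2 a3 a4 p y1 y2 y3 y4 q12 q13 q14 q23 q24 q34 w123 w124 w134 w234 r :: complex
  defines "Q12 \<equiv> quad_H3 \<delta> (e * a3 * a4) a1 a2"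
    and "Q13 \<equiv> quad_H3 \<delta> (e * a2 * a4) a1 a3"
    and "Q14 \<equiv> quad_H3 \<delta> (e * a2 * a3) a1 a4"
    and "Q23 \<equiv> quad_H3 \<delta> (e * a1 * a4) a2 a3"
    and "Q24 \<equiv> quad_H3 \<delta> (e * a1 * a3) a2 a4"
    and "Q34 \<equiv> quad_H3 \<delta> (e * a1 * a2) a3 a4"
  shows "a1 * a2 * slope (Q34 p y3 y4) * Q12 q34 w134 w234 r =
     a3 * a4 * slope (Q12 p y1 y2) * Q14 q12 y2 w124 q24
    - a3 * a4 * slope (Q12 p y1 y2) * Q34 q12 w123 w124 r
    + a2 * a4 * slope (Q13 p y1 y3) * Q24 q13 w123 w134 r
    - a2 * a4 * slope (Q13 p y1 y3) * Q23 q12 y1 w123 q13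
    - a2 * a4 * slope (Q13 p y1 y3) * Q34 q13 y1 w134 q14
    - a2 * a3 * slope (Q14 p y1 y4) * Q12 q14 y4 w124 q24
    - a2 * a3 * slope (Q14 p y1 y4) * Q23 q14 w124 w134 r
    + a1 * a4 * slope (Q23 p y2 y3) * Q13 q12 y2 w123 q23
    + a1 * a4 * slope (Q23 p y2 y3) * Q34 q23 y2 w234 q24
    - a1 * a4 * slope (Q23 p y2 y3) * Q14 q23 w123 w234 r
    + a1 * a3 * slope (Q24 p y2 y4) * Q13 q24 w124 w234 r
    + a1 * a2 * slope (Q34 p y3 y4) * Q13 q14 y4 w134 q34
    - a1 * a2 * slope (Q34 p y3 y4) * Q23 q24 y4 w234 q34
    + (a2 * a4 * (a3 * y1 - a1 * y3)
       + e * a3 * a4 * ((a1^2 - a4^2) * a2 * a3 * q24 + (a4^2 - a3^2) * a1 * a2 * r)) * Q12 p y1 y2 q12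
    + (e * a2 * a4 * ((a3^2 - a2^2) * a1 * a4 * q12 + (a4^2 - a3^2) * a1 * a2 * q14 + (a2^2 - a4^2) * a1 * a3 * r))
       * Q13 p y1 y3 q13
    + (a2 * a4 * (a1 * y3 - a3 * y1)
       + e * a2 * a3 * ((a2^2 - a1^2) * a3 * a4 * q24 + (a3^2 - a2^2) * a1 * a4 * r)) * Q14 p y1 y4 q14
    + (e * a1 * a4 * ((a1^2 - a3^2) * a2 * a4 * q12 + (a3^2 - a4^2) * a1 * a2 * q24 + (a4^2 - a1^2) * a2 * a3 * r))
       * Q23 p y2 y3 q23
    + (a2 * a4 * (a3 * y1 - a1 * y3) + e * a1 * a3 * ((a1^2 - a3^2) * a2 * a4 * r)) * Q24 p y2 y4 q24
    + (e * a1 * a2 * ((a1^2 - a3^2) * a2 * a4 * q14 + (a3^2 - a2^2) * a1 * a4 * q24 + (a2^2 - a1^2) * a3 * a4 * r))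
       * Q34 p y3 y4 q34"
  unfolding assms slope_def quad_H3_def by algebra

text \<open>In the identities the wanted face is multiplied only by the coefficient of
  \<open>q34\<close> in the face at \<open>p\<close>, for H3 also by \<open>a1 * a2\<close>.
  Uniqueness of \<open>q34\<close> makes this factor nonzero.\<close>

lemma tesseract_black:
  assumes params: "admissible_param K a1" "admissible_param K a2" "admissible_param K a3" "admissible_param K a4"
    and F: "black_quad K \<epsilon> \<delta> a1 a2 p y1 y2 q12 = 0"
      "black_quad K \<epsilon> \<delta> a1 a3 p y1 y3 q13 = 0"
      "black_quad K \<epsilon> \<delta> a1 a4 p y1 y4 q14 = 0"
      "black_quad K \<epsilon> \<delta> a2 a3 p y2 y3 q23 = 0"
      "black_quad K \<epsilon> \<delta> a2 a4 p y2 y4 q24 = 0"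
      "black_quad K \<epsilon> \<delta> a3 a4 p y3 y4 q34 = 0"
    and G: "black_quad K \<epsilon> \<delta> a1 a2 q14 y4 w124 q24 = 0"
      "black_quad K \<epsilon> \<delta> a1 a3 q12 y2 w123 q23 = 0"
      "black_quad K \<epsilon> \<delta> a1 a3 q14 y4 w134 q34 = 0"
      "black_quad K \<epsilon> \<delta> a1 a3 q24 w124 w234 r = 0"
      "black_quad K \<epsilon> \<delta> a1 a4 q12 y2 w124 q24 = 0"
      "black_quad K \<epsilon> \<delta> a1 a4 q23 w123 w234 r = 0"
      "black_quad K \<epsilon> \<delta> a2 a3 q12 y1 w123 q13 = 0"
      "black_quad K \<epsilon> \<delta> a2 a3 q24 y4 w234 q34 = 0"
      "black_quad K \<epsilon> \<delta> a2 a3 q14 w124 w134 r = 0"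
      "black_quad K \<epsilon> \<delta> a2 a4 q13 w123 w134 r = 0"
      "black_quad K \<epsilon> \<delta> a3 a4 q13 y1 w134 q14 = 0"
      "black_quad K \<epsilon> \<delta> a3 a4 q23 y2 w234 q24 = 0"
      "black_quad K \<epsilon> \<delta> a3 a4 q12 w123 w124 r = 0"
    and q34: "\<exists>!x. black_quad K \<epsilon> \<delta> a3 a4 p y3 y4 x = 0"
  shows "black_quad K \<epsilon> \<delta> a1 a2 q34 w134 w234 r = 0"
proof -
  define Q where "Q = black_quad K \<epsilon> \<delta>"
  have nondeg: "slope (Q a3 a4 p y3 y4) \<noteq> 0"
    unfolding Q_def using q34 by (intro slope_nonzero black_quad_affine_black)
  show ?thesis
  proof (cases K)
    case H1
    then show ?thesis
      using tesseract_identity_H1[of \<epsilon> \<delta> a3 a4 p y3 y4 a1 a2 q34 w134 w234 r y1 y2 q12 w124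
          q24 w123 q13 q14 q23] nondeg F G
      by (simp add: Q_def)
  next
    case H2
    then show ?thesis
      using tesseract_identity_H2[of \<epsilon> \<delta> a3 a4 p y3 y4 a1 a2 q34 w134 w234 r y1 y2 q12 w124
          q24 w123 q13 q14 q23] nondeg F G
      by (simp add: Q_def)
  next
    case H3
    with params have nz: "a1 \<noteq> 0" "a2 \<noteq> 0" "a3 \<noteq> 0" "a4 \<noteq> 0"
      by (simp_all add: admissible_param_def)
    define e where "e = \<epsilon> / (a1 * a2 * a3 * a4)"
    have "\<epsilon> = (e * a3 * a4) * a1 * a2" "\<epsilon> = (e * a2 * a4) * a1 * a3" "\<epsilon> = (e * a2 * a3) * a1 * a4"
        "\<epsilon> = (e * a1 * a4) * a2 * a3" "\<epsilon> = (e * a1 * a3) * a2 * a4" "\<epsilon> = (e * a1 * a2) * a3 * a4"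
      using nz by (simp_all add: e_def)
    with nz have "Q a1 a2 = quad_H3 \<delta> (e * a3 * a4) a1 a2" "Q a1 a3 = quad_H3 \<delta> (e * a2 * a4) a1 a3"
        "Q a1 a4 = quad_H3 \<delta> (e * a2 * a3) a1 a4" "Q a2 a3 = quad_H3 \<delta> (e * a1 * a4) a2 a3"
        "Q a2 a4 = quad_H3 \<delta> (e * a1 * a3) a2 a4" "Q a3 a4 = quad_H3 \<delta> (e * a1 * a2) a3 a4"
      unfolding Q_def H3 by (blast intro: black_quad_H3)+
    then show ?thesis
      using tesseract_identity_H3[of a1 a2 \<delta> e a3 a4 p y3 y4 q34 w134 w234 r y1 y2 q12 w124
          q24 w123 q13 q14 q23] nondeg F G nz
      by (simp add: Q_def[symmetric])
  qed
qed

subsection \<open>Faces with either colouring\<close>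

text \<open>The flag \<open>white\<close> is the colour of \<open>x1\<close>. Reflection along the
  first direction brings the black diagonal \<open>x2, x3\<close> into place while each parameter
  keeps its edges.\<close>

definition face :: "deformed_family \<Rightarrow> complex \<Rightarrow> complex \<Rightarrow> bool \<Rightarrow> complex \<Rightarrow> complex \<Rightarrow>
    complex \<Rightarrow> complex \<Rightarrow> complex \<Rightarrow> complex \<Rightarrow> complex" where
  "face K \<epsilon> \<delta> white a b x1 x2 x3 x4 =
     (if white then black_quad K \<epsilon> \<delta> a b x2 x1 x4 x3 else black_quad K \<epsilon> \<delta> a b x1 x2 x3 x4)"

text \<open>For white \<open>x1\<close>, exchanging the directions also exchanges the two black
  vertices, hence the additional half turn.\<close>

lemma face_swap: "face K \<epsilon> \<delta> s b a x1 x3 x2 x4 = 0 \<longleftrightarrow> face K \<epsilon> \<delta> s a b x1 x2 x3 x4 = 0"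
  using black_quad_swap[of K \<epsilon> \<delta> b a x1 x3 x2 x4] black_quad_swap[of K \<epsilon> \<delta> b a x3 x1 x4 x2]
    black_quad_flip[of K \<epsilon> \<delta> a b x3 x4 x1 x2]
  by (simp add: face_def)

text \<open>
  If the base vertex \<open>u\<close> is white, reflecting the first direction makes the base vertex black without
  changing any of the equations.
\<close>

lemma cube_face:
  assumes params: "admissible_param K a1" "admissible_param K a2" "admissible_param K a3"
    and faces: "face K \<epsilon> \<delta> s a1 a2 u u1 v v1 = 0" "face K \<epsilon> \<delta> s a1 a3 u u1 w w1 = 0"
      "face K \<epsilon> \<delta> s a2 a3 u v w x = 0" "face K \<epsilon> \<delta> (\<not> s) a2 a3 u1 v1 w1 x1 = 0"
    and uniq: "\<exists>!z. face K \<epsilon> \<delta> s a2 a3 u v w z = 0" "\<exists>!z. face K \<epsilon> \<delta> (\<not> s) a2 a3 u1 v1 w1 z = 0"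
  shows "face K \<epsilon> \<delta> (\<not> s) a1 a3 v v1 x x1 = 0"
proof (cases s)
  case True
  then show ?thesis
    using cube_black[OF params, of \<epsilon> \<delta> u1 u v1 v w1 w x1 x] faces uniq by (simp add: face_def)
next
  case False
  then show ?thesis
    using cube_black[OF params, of \<epsilon> \<delta> u u1 v v1 w w1 x x1] faces uniq by (simp add: face_def)
qed

text \<open>Letters record the position in directions \<open>a3\<close>, \<open>a4\<close>, indices
  that in \<open>a1\<close>, \<open>a2\<close>. For white \<open>u\<close> the black base vertex is
  \<open>u1\<close>, whose square then supplies the solvability.\<close>

lemma tesseract_face:
  assumes params: "admissible_param K a1" "admissible_param K a2" "admissible_param K a3" "admissible_param K a4"
    and "face K \<epsilon> \<delta> s a1 a2 u u1 u2 u3 = 0"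
      "face K \<epsilon> \<delta> (\<not> s) a1 a2 v v1 v2 v3 = 0" "face K \<epsilon> \<delta> (\<not> s) a1 a2 w w1 w2 w3 = 0"
      "face K \<epsilon> \<delta> s a1 a3 u u1 v v1 = 0" "face K \<epsilon> \<delta> (\<not> s) a1 a3 u2 u3 v2 v3 = 0"
      "face K \<epsilon> \<delta> (\<not> s) a1 a3 w w1 x x1 = 0" "face K \<epsilon> \<delta> s a1 a3 w2 w3 x2 x3 = 0"
      "face K \<epsilon> \<delta> s a2 a3 u u2 v v2 = 0" "face K \<epsilon> \<delta> (\<not> s) a2 a3 u1 u3 v1 v3 = 0"
      "face K \<epsilon> \<delta> (\<not> s) a2 a3 w w2 x x2 = 0" "face K \<epsilon> \<delta> s a2 a3 w1 w3 x1 x3 = 0"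
      "face K \<epsilon> \<delta> s a1 a4 u u1 w w1 = 0" "face K \<epsilon> \<delta> (\<not> s) a1 a4 u2 u3 w2 w3 = 0"
      "face K \<epsilon> \<delta> (\<not> s) a1 a4 v v1 x x1 = 0" "face K \<epsilon> \<delta> s a1 a4 v2 v3 x2 x3 = 0"
      "face K \<epsilon> \<delta> s a2 a4 u u2 w w2 = 0" "face K \<epsilon> \<delta> (\<not> s) a2 a4 u1 u3 w1 w3 = 0"
      "face K \<epsilon> \<delta> (\<not> s) a2 a4 v v2 x x2 = 0" "face K \<epsilon> \<delta> s a2 a4 v1 v3 x1 x3 = 0"
      "face K \<epsilon> \<delta> s a3 a4 u v w x = 0" "face K \<epsilon> \<delta> (\<not> s) a3 a4 u1 v1 w1 x1 = 0"
      "face K \<epsilon> \<delta> (\<not> s) a3 a4 u2 v2 w2 x2 = 0" "face K \<epsilon> \<delta> s a3 a4 u3 v3 w3 x3 = 0"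
    and "\<exists>!z. face K \<epsilon> \<delta> s a3 a4 u v w z = 0" "\<exists>!z. face K \<epsilon> \<delta> (\<not> s) a3 a4 u1 v1 w1 z = 0"
  shows "face K \<epsilon> \<delta> s a1 a2 x x1 x2 x3 = 0"
proof (cases s)
  case True
  show ?thesis
    using assms(5-)
    by (simp add: True face_def, intro tesseract_black[OF params,
        where p = u1 and ?y1.0 = u and ?y2.0 = u3 and ?y3.0 = v1 and ?y4.0 = w1 and ?q12.0 = u2
          and ?q13.0 = v and ?q14.0 = w and ?q23.0 = v3 and ?q24.0 = w3 and ?q34.0 = x1 and ?w123.0 = v2
          and ?w124.0 = w2 and ?w134.0 = x and ?w234.0 = x3 and r = x2])
next
  case False
  show ?thesis
    using assms(5-)
    by (simp add: False face_def, intro tesseract_black[OF params,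
        where p = u and ?y1.0 = u1 and ?y2.0 = u2 and ?y3.0 = v and ?y4.0 = w and ?q12.0 = u3
          and ?q13.0 = v1 and ?q14.0 = w1 and ?q23.0 = v2 and ?q24.0 = w2 and ?q34.0 = x and ?w123.0 = v3
          and ?w124.0 = w3 and ?w134.0 = x1 and ?w234.0 = x2 and r = x3])
qed

text \<open>Here \<open>chi_X\<close> is 1 and \<open>chi_Y\<close> is 0, so the term with
  \<epsilon> involves \<open>x2\<close> and \<open>x3\<close>, not the base vertex.\<close>

definition white :: "complex \<Rightarrow> int \<Rightarrow> int \<Rightarrow> bool" where
  "white \<sigma> n m \<longleftrightarrow> \<sigma> * (-1) powi (n + m) = 1"

text \<open>A sign change flips the colour just as a lattice shift does, so a Backlund
  transformation acts as a step in a further lattice direction.\<close>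

lemma white_simps:
  assumes "\<sigma> = 1 \<or> \<sigma> = -1"
  shows "white (- \<sigma>) n m \<longleftrightarrow> \<not> white \<sigma> n m"
    "white \<sigma> (n + 1) m \<longleftrightarrow> \<not> white \<sigma> n m" "white \<sigma> n (m + 1) \<longleftrightarrow> \<not> white \<sigma> n m"
  using assms by (auto simp: white_def power_int_minus_left)

lemma quad_poly_eq_face:
  assumes "\<sigma> = 1 \<or> \<sigma> = -1"
  shows "quad_poly K \<epsilon> \<delta> x1 x2 x3 x4 n m a b \<sigma> = face K \<epsilon> \<delta> (white \<sigma> n m) a b x1 x2 x3 x4"
proof -
  have "chi_X n m \<sigma> = (if white \<sigma> n m then 1 else 0)" "chi_Y n m \<sigma> = (if white \<sigma> n m then 0 else 1)"
    using assms by (auto simp: chi_X_def chi_Y_def white_def power_int_minus_left)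
  then show ?thesis
    by (cases K) (simp_all add: face_def algebra_simps)
qed

section \<open>Superposition on the lattice\<close>

theorem proposition4p2:
  fixes K :: deformed_family
    and \<epsilon> \<delta> \<alpha> \<beta> l1 l2 \<sigma> :: complex
    and u0 v1 v2 :: "int \<Rightarrow> int \<Rightarrow> complex"
  assumes sign: "\<sigma> = 1 \<or> \<sigma> = -1"
    and params: "admissible_param K \<alpha>" "admissible_param K \<beta>"
                "admissible_param K l1" "admissible_param K l2"
    and u0: "is_solution K \<epsilon> \<delta> \<alpha> \<beta> \<sigma> u0"
    and v1: "backlund K \<epsilon> \<delta> \<alpha> \<beta> l1 \<sigma> u0 v1"
    and v2: "backlund K \<epsilon> \<delta> \<alpha> \<beta> l2 \<sigma> u0 v2"
    and solvable: "\<forall>n m. \<exists>!x. quad_poly K \<epsilon> \<delta> (u0 n m) (v1 n m) (v2 n m) x n m l1 l2 \<sigma> = 0"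
  shows "\<exists>u12. is_solution K \<epsilon> \<delta> \<alpha> \<beta> \<sigma> u12
             \<and> backlund K \<epsilon> \<delta> \<alpha> \<beta> l2 (-\<sigma>) v1 u12
             \<and> backlund K \<epsilon> \<delta> \<alpha> \<beta> l1 (-\<sigma>) v2 u12
             \<and> (\<forall>n m. quad_poly K \<epsilon> \<delta> (u0 n m) (v1 n m) (v2 n m) (u12 n m) n m l1 l2 \<sigma> = 0)"
proof -
  have sign': "- \<sigma> = 1 \<or> - \<sigma> = -1"
    using sign by auto
  note flip = white_simps[OF sign]
  note to_face = quad_poly_eq_face[OF sign] quad_poly_eq_face[OF sign']
  define s where "s = white \<sigma>"
  define F where "F = face K \<epsilon> \<delta>"
  note s_simps [simp] = flip[folded s_def]
  have U: "F (s n m) \<alpha> \<beta> (u0 n m) (u0 (n+1) m) (u0 n (m+1)) (u0 (n+1) (m+1)) = 0" for n m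
    using u0 by (simp add: is_solution_def to_face F_def s_def)
  have V: "F (\<not> s n m) \<alpha> \<beta> (v n m) (v (n+1) m) (v n (m+1)) (v (n+1) (m+1)) = 0"
      "F (s n m) \<alpha> l (u0 n m) (u0 (n+1) m) (v n m) (v (n+1) m) = 0"
      "F (s n m) \<beta> l (u0 n m) (u0 n (m+1)) (v n m) (v n (m+1)) = 0"
    if "backlund K \<epsilon> \<delta> \<alpha> \<beta> l \<sigma> u0 v" for l v n m
    using that flip by (simp_all add: backlund_def is_solution_def to_face F_def s_def)
  have uniq: "\<exists>!x. F (s n m) l1 l2 (u0 n m) (v1 n m) (v2 n m) x = 0" for n m
    using solvable by (simp add: to_face F_def s_def)
  \<comment> \<open>The superposition formula defines \<open>u12\<close> pointwise; both arrows and
    the lattice equation remain to be derived.\<close>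
  then obtain u12 where u12: "F (s n m) l1 l2 (u0 n m) (v1 n m) (v2 n m) (u12 n m) = 0" for n m
    by metis
  \<comment> \<open>The formula is symmetric under exchanging the two transformations, so one cube
    argument serves both arrows.\<close>
  have uniq': "\<exists>!x. F (s n m) l2 l1 (u0 n m) (v2 n m) (v1 n m) x = 0" for n m
    using uniq[of n m] by (simp add: F_def face_swap)
  have u12': "F (s n m) l2 l1 (u0 n m) (v2 n m) (v1 n m) (u12 n m) = 0" for n m
    using u12[of n m] by (simp add: F_def face_swap)
  \<comment> \<open>The cubes have directions \<alpha>, \<open>l1\<close>, \<open>l2\<close> and
    \<beta>, \<open>l1\<close>, \<open>l2\<close>; the opposite superposition face sits at the
    neighbouring lattice point, with the colour flipped.\<close>
  have v1_u12: "F (\<not> s n m) \<alpha> l2 (v1 n m) (v1 (n+1) m) (u12 n m) (u12 (n+1) m) = 0"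
      "F (\<not> s n m) \<beta> l2 (v1 n m) (v1 n (m+1)) (u12 n m) (u12 n (m+1)) = 0" for n m
    using cube_face[OF params(1,3,4), where \<epsilon>=\<epsilon> and \<delta>=\<delta>, folded F_def, OF V(2)[OF v1] V(2)[OF v2] u12 _ uniq, of n m "u12 (n+1) m"]
      cube_face[OF params(2,3,4), where \<epsilon>=\<epsilon> and \<delta>=\<delta>, folded F_def, OF V(3)[OF v1] V(3)[OF v2] u12 _ uniq, of n m "u12 n (m+1)"]
      u12[of "n+1" m] uniq[of "n+1" m] u12[of n "m+1"] uniq[of n "m+1"] by simp_all
  have v2_u12: "F (\<not> s n m) \<alpha> l1 (v2 n m) (v2 (n+1) m) (u12 n m) (u12 (n+1) m) = 0"
      "F (\<not> s n m) \<beta> l1 (v2 n m) (v2 n (m+1)) (u12 n m) (u12 n (m+1)) = 0" for n m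
    using cube_face[OF params(1,4,3), where \<epsilon>=\<epsilon> and \<delta>=\<delta>, folded F_def, OF V(2)[OF v2] V(2)[OF v1] u12' _ uniq', of n m "u12 (n+1) m"]
      cube_face[OF params(2,4,3), where \<epsilon>=\<epsilon> and \<delta>=\<delta>, folded F_def, OF V(3)[OF v2] V(3)[OF v1] u12' _ uniq', of n m "u12 n (m+1)"]
      u12'[of "n+1" m] uniq'[of "n+1" m] u12'[of n "m+1"] uniq'[of n "m+1"] by simp_all
  \<comment> \<open>Only the face of \<open>u12\<close> is still open in the cube with directions
    \<alpha>, \<beta>, \<open>l1\<close>, \<open>l2\<close>.\<close>
  have u12_solution: "F (s n m) \<alpha> \<beta> (u12 n m) (u12 (n+1) m) (u12 n (m+1)) (u12 (n+1) (m+1)) = 0" for n m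
  proof (rule tesseract_face[OF params, where \<epsilon>=\<epsilon> and \<delta>=\<delta>, folded F_def])
    show "F (s n m) \<alpha> \<beta> (u0 n m) (u0 (n+1) m) (u0 n (m+1)) (u0 (n+1) (m+1)) = 0"
      by (rule U)
  qed (use V[OF v1, of n m] V[OF v2, of n m] V[OF v1, of "n+1" m] V[OF v2, of "n+1" m]
        V[OF v1, of n "m+1"] V[OF v2, of n "m+1"] v1_u12[of n m] v2_u12[of n m] v1_u12[of "n+1" m]
        v2_u12[of "n+1" m] v1_u12[of n "m+1"] v2_u12[of n "m+1"] u12[of n m] u12[of "n+1" m]
        u12[of n "m+1"] u12[of "n+1" "m+1"] uniq[of n m] uniq[of "n+1" m] in simp_all)
  show ?thesis
  proof (intro exI conjI)
    show sol: "is_solution K \<epsilon> \<delta> \<alpha> \<beta> \<sigma> u12"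
      using u12_solution by (simp add: is_solution_def to_face F_def s_def)
    show "backlund K \<epsilon> \<delta> \<alpha> \<beta> l2 (-\<sigma>) v1 u12"
      using v1 v1_u12 sol flip by (simp add: backlund_def to_face F_def s_def)
    show "backlund K \<epsilon> \<delta> \<alpha> \<beta> l1 (-\<sigma>) v2 u12"
      using v2 v2_u12 sol flip by (simp add: backlund_def to_face F_def s_def)
    show "\<forall>n m. quad_poly K \<epsilon> \<delta> (u0 n m) (v1 n m) (v2 n m) (u12 n m) n m l1 l2 \<sigma> = 0"
      using u12 by (simp add: to_face F_def s_def)
  qed
qed

end
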